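(* Let $\mathcal{H}$ be a real Hilbert space and let $T:\mathcal{H}\to\mathcal{H}$ be a nonexpansive mapping with $Fix(T)\neq\emptyset$. Let $x^0\in\mathcal{H}$ be arbitrary and let $\{x^k\}_{k=0}^\infty$ be the sequence generated by $$x^k=\frac{1}{\varphi_k+1}x^0+\frac{\varphi_k}{\varphi_k+1}Tx^{k-1},\qquad \varphi_k:=\frac{2\langle x^{k-1}-Tx^{k-1},\,x^0-x^{k-1}\rangle}{\|x^{k-1}-Tx^{k-1}\|^2}+1,\qquad k\ge 1,$$ where it is assumed that $x^k\neq Tx^k$ for all $k\ge 0$. Then, for every fixed point $x^*$ of $T$, $$\|x^k-Tx^k\|\le\frac{2}{\varphi_k+1}\|x^0-x^*\|\qquad\text{for all } k\ge 1.$$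
   Context: A mapping $T:\mathcal{H}\to\mathcal{H}$ is nonexpansive if $\|Tx-Ty\|\le\|x-y\|$ for all $x,y\in\mathcal{H}$. $Fix(T)=\{x\in\mathcal{H}: x=Tx\}$. The sequence is the Halpern iteration with adaptive anchoring parameters: for $k=1,2,\dots$, given $x^{k-1}$, the process terminates if $x^{k-1}=Tx^{k-1}$; otherwise $\varphi_k$ and then $x^k$ are computed by the displayed formulas. Standing assumption: $x^k\ne Tx^k$ for all $k\ge 0$, i.e. an infinite sequence is generated. *)

theory Defs
  imports "HOL-Analysis.Analysis"
begin

definition nonexpansive :: "('a::real_normed_vector \<Rightarrow> 'a) \<Rightarrow> bool" where
  "nonexpansive T \<longleftrightarrow> (\<forall>x y. norm (T x - T y) \<le> norm (x - y))"

definition Fix :: "('a \<Rightarrow> 'a) \<Rightarrow> 'a set" where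
  "Fix T = {x. x = T x}"

end

theory Submission
  imports Defs
begin

text \<open>
  Write \<open>r\<^sub>k = x\<^sup>k - T x\<^sup>k\<close>. The choice of \<open>\<phi>\<^sub>k\<close> is exactly what makes
  \<open>\<parallel>r\<^sub>k\<^sub>-\<^sub>1\<parallel>\<^sup>2 = 2 \<langle>r\<^sub>k\<^sub>-\<^sub>1, x\<^sup>k - T x\<^sup>k\<^sup>-\<^sup>1\<rangle>\<close>, so that nonexpansiveness between \<open>x\<^sup>k\<close> and \<open>x\<^sup>k\<^sup>-\<^sup>1\<close>
  collapses to \<open>\<phi>\<^sub>k \<parallel>r\<^sub>k\<parallel>\<^sup>2 \<le> 2 \<langle>r\<^sub>k, x\<^sup>0 - x\<^sup>k\<rangle>\<close>, that is, \<open>\<phi>\<^sub>k\<^sub>+\<^sub>1 \<ge> \<phi>\<^sub>k + 1\<close>. Adding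
  \<open>\<parallel>r\<^sub>k\<parallel>\<^sup>2 \<le> 2 \<langle>r\<^sub>k, x\<^sup>k - x\<^sup>*\<rangle>\<close> for a fixed point \<open>x\<^sup>*\<close> and applying Cauchy--Schwarz gives the
  bound.
\<close>

lemma halpern_step_residual:
  fixes T :: "'a::real_inner \<Rightarrow> 'a"
  assumes T: "nonexpansive T"
    and "y \<noteq> T y" and "\<phi> \<ge> 0"
    and \<phi>: "\<phi> = 2 * inner (y - T y) (u - y) / (norm (y - T y))\<^sup>2 + 1"
    and z: "z = (1 / (\<phi> + 1)) *\<^sub>R u + (\<phi> / (\<phi> + 1)) *\<^sub>R T y"
  shows "\<phi> * (norm (z - T z))\<^sup>2 \<le> 2 * inner (z - T z) (u - z)"
proof -
  define s where "s = y - T y"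
  define r where "r = z - T z"
  define d where "d = z - T y"
  have "(\<phi> + 1) *\<^sub>R z = u + \<phi> *\<^sub>R T y"
    using \<open>\<phi> \<ge> 0\<close> by (simp add: z scaleR_add_right)
  then have u: "u = z + \<phi> *\<^sub>R d"
    by (simp add: d_def algebra_simps)
  have "(\<phi> - 1) * (norm s)\<^sup>2 = 2 * inner s (u - y)"
    using \<phi> \<open>y \<noteq> T y\<close> by (simp add: s_def field_simps)
  \<comment> \<open>Pairing this with \<open>2 *\<^sub>R s\<close> contributes
    \<open>- 2 * (norm s)\<^sup>2\<close>, which turns the factor \<open>\<phi> - 1\<close> into
    \<open>\<phi> + 1\<close>, so that it cancels.\<close>
  moreover have "u - y = (\<phi> + 1) *\<^sub>R d - s"
    by (simp add: u s_def d_def algebra_simps)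
  ultimately have "(\<phi> + 1) * (norm s)\<^sup>2 = (\<phi> + 1) * (2 * inner s d)"
    by (simp add: inner_diff_right power2_norm_eq_inner algebra_simps)
  then have s: "(norm s)\<^sup>2 = 2 * inner s d"
    using \<open>\<phi> \<ge> 0\<close> by simp
  \<comment> \<open>Here \<open>d - r = T z - T y\<close> and \<open>d - s = z - y\<close>; after
    squaring, the identity for \<open>(norm s)\<^sup>2\<close> reduces the right side to
    \<open>(norm d)\<^sup>2\<close>.\<close>
  have "norm (d - r) \<le> norm (d - s)"
    using T by (simp add: nonexpansive_def d_def r_def s_def)
  then have "(norm (d - r))\<^sup>2 \<le> (norm (d - s))\<^sup>2"
    by simp
  with s have "(norm r)\<^sup>2 \<le> 2 * inner r d"
    by (simp add: power2_norm_eq_inner inner_diff_left inner_diff_right inner_commute)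
  then have "\<phi> * (norm r)\<^sup>2 \<le> \<phi> * (2 * inner r d)"
    using \<open>\<phi> \<ge> 0\<close> by (rule mult_left_mono)
  also have "\<dots> = 2 * inner r (u - z)"
    by (simp add: u)
  finally show ?thesis
    by (simp add: r_def)
qed

text \<open>Cocoercivity of \<open>z - T z\<close>, specialised to a point where this residual
  vanishes.\<close>

lemma nonexpansive_residual_inner_fixpoint:
  fixes T :: "'a::real_inner \<Rightarrow> 'a"
  assumes "nonexpansive T" and "p \<in> Fix T"
  shows "(norm (z - T z))\<^sup>2 \<le> 2 * inner (z - T z) (z - p)"
proof -
  define r where "r = z - T z"
  define d where "d = z - p"
  have "T p = p"
    using assms(2) by (simp add: Fix_def)
  then have "T z - T p = d - r"
    by (simp add: r_def d_def)
  then have "norm (d - r) \<le> norm d"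
    using assms(1) by (metis nonexpansive_def d_def)
  then have "(norm (d - r))\<^sup>2 \<le> (norm d)\<^sup>2"
    by simp
  then have "(norm r)\<^sup>2 \<le> 2 * inner r d"
    by (simp add: power2_norm_eq_inner inner_diff_left inner_diff_right inner_commute)
  then show ?thesis
    by (simp add: r_def d_def)
qed

lemma residual_bound:
  fixes T :: "'a::real_inner \<Rightarrow> 'a"
  assumes "nonexpansive T" and "p \<in> Fix T" and "\<phi> \<ge> 0"
    and "\<phi> * (norm (z - T z))\<^sup>2 \<le> 2 * inner (z - T z) (u - z)"
  shows "norm (z - T z) \<le> 2 / (\<phi> + 1) * norm (u - p)"
proof (cases "z = T z")
  case False
  let ?r = "z - T z"
  have "(\<phi> + 1) * (norm ?r)\<^sup>2 \<le> 2 * inner ?r (u - z) + 2 * inner ?r (z - p)"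
    using assms(4) nonexpansive_residual_inner_fixpoint[OF assms(1,2), of z]
    by (simp add: distrib_right)
  also have "\<dots> = 2 * inner ?r (u - p)"
    by (simp add: inner_diff_right)
  also have "\<dots> \<le> 2 * (norm ?r * norm (u - p))"
    using norm_cauchy_schwarz by simp
  finally have "norm ?r * ((\<phi> + 1) * norm ?r) \<le> norm ?r * (2 * norm (u - p))"
    by (simp add: power2_eq_square mult_ac)
  then have "(\<phi> + 1) * norm ?r \<le> 2 * norm (u - p)"
    using False by (simp add: mult_le_cancel_left)
  then show ?thesis
    using \<open>\<phi> \<ge> 0\<close> by (simp add: field_simps)
qed (use \<open>\<phi> \<ge> 0\<close> in simp)

theorem theorem3p2:
  fixes T :: "'a::{real_inner, complete_space} \<Rightarrow> 'a"
    and x :: "nat \<Rightarrow> 'a"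
    and \<phi> :: "nat \<Rightarrow> real"
  assumes "nonexpansive T"
    and "Fix T \<noteq> {}"
    and "\<And>k. k \<ge> 1 \<Longrightarrow>
      \<phi> k = 2 * inner (x (k - 1) - T (x (k - 1))) (x 0 - x (k - 1))
              / (norm (x (k - 1) - T (x (k - 1))))\<^sup>2 + 1"
    and "\<And>k. k \<ge> 1 \<Longrightarrow>
      x k = (1 / (\<phi> k + 1)) *\<^sub>R x 0 + (\<phi> k / (\<phi> k + 1)) *\<^sub>R T (x (k - 1))"
    and "\<And>k. x k \<noteq> T (x k)"
  shows "\<forall>xstar \<in> Fix T. \<forall>k\<ge>1.
      norm (x k - T (x k)) \<le> 2 / (\<phi> k + 1) * norm (x 0 - xstar)"
proof -
  have residual: "\<phi> k * (norm (x k - T (x k)))\<^sup>2 \<le> 2 * inner (x k - T (x k)) (x 0 - x k)"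
    if "k \<ge> 1" "\<phi> k \<ge> 0" for k
    using halpern_step_residual[OF assms(1,5) that(2) assms(3)[OF that(1)] assms(4)[OF that(1)]] .
  \<comment> \<open>\<open>residual\<close> at \<open>k\<close> makes the numerator in
    \<open>\<phi> (Suc k)\<close> nonnegative but itself requires \<open>\<phi> k \<ge> 0\<close>,
    hence the induction. It starts from \<open>\<phi> 1 = 1\<close>, as \<open>x 0 - x 0\<close>
    vanishes.\<close>
  have nonneg: "\<phi> k \<ge> 0" if "k \<ge> 1" for k
    using that
  proof (induction k rule: dec_induct)
    case base
    then show ?case
      using assms(3)[of 1] by simp
  next
    case (step k)
    have "0 \<le> \<phi> k * (norm (x k - T (x k)))\<^sup>2"
      using step.IH by simp
    also have "\<dots> \<le> 2 * inner (x k - T (x k)) (x 0 - x k)"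
      using step.hyps(1) step.IH by (rule \<open>\<And>k. \<lbrakk>k \<ge> 1; \<phi> k \<ge> 0\<rbrakk> \<Longrightarrow> _ k\<close>)
    finally show ?case
      using assms(3)[of "Suc k"] by simp
  qed
  show ?thesis
    using residual_bound[OF assms(1)] residual nonneg by blast
qed

end
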